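(* Let $A_1,\dots,A_M\in\mathbb{R}^{n\times n}$, $\mathcal{M}=\{1,\dots,M\}$ and $A(w)=\sum_{i\in\mathcal{M}}w_iA_i$ for $w\in\mathcal{W}$. Let $V$ be a smooth weak Lyapunov function for the differential inclusion $\dot x(t)=A(w(t))x(t)$. Then every solution $x(t)$ of the differential inclusion converges to the set $$\mathcal{N}=\Big\{x\in\mathbb{R}^n\ \Big|\ \min_{i\in\mathcal{M}}\{-\nabla V(x)A_ix\}=0\Big\}.$$
   Context: $\mathcal{W}=\{w\in\mathbb{R}^M:\ \sum_{i\in\mathcal{M}}w_i=1,\ w_i\ge0\ \forall i\in\mathcal{M}\}$; solutions are those generated by measurable functions $w(t)\in\mathcal{W}$, $t\ge0$, and arbitrary $x(0)\in\mathbb{R}^n$. A smooth weak Lyapunov function is a smooth positive definite function $V:\mathbb{R}^n\to\mathbb{R}_{\ge0}$ such that $\nabla V(x)A(w)x\le0$ for all $x\in\mathbb{R}^n$ and $w\in\mathcal{W}$, with $\nabla V(x)$ the gradient as a row vector. Convergence to a set means that the distance from $x(t)$ to the set tends to $0$ as $t\to\infty$. *)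

theory Defs
  imports "HOL-Analysis.Analysis"
begin

text \<open>
  The system matrices are indexed by a finite type \<open>'m\<close> (so $M = \mathrm{CARD}('m) \ge 1$) and act
  on \<open>real ^ 'n\<close>.
\<close>

definition weights :: "(real ^ 'm) set" where
  "weights = {w. (\<Sum>i\<in>UNIV. w $ i) = 1 \<and> (\<forall>i. 0 \<le> w $ i)}"

definition weighted_matrix :: "('m::finite \<Rightarrow> real ^ 'n ^ 'n) \<Rightarrow> real ^ 'm \<Rightarrow> real ^ 'n ^ 'n" where
  "weighted_matrix A w = (\<Sum>i\<in>UNIV. w $ i *\<^sub>R A i)"

text \<open>
  \<open>C_k k f\<close>: \<open>f\<close> is \<open>k\<close> times continuously (Frechet) differentiable on the whole space.  In
  finite dimension, continuity of the derivative in operator norm is the same as continuity of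
  all directional derivatives.
\<close>

primrec C_k :: "nat \<Rightarrow> ('a::euclidean_space \<Rightarrow> real) \<Rightarrow> bool" where
  "C_k 0 f \<longleftrightarrow> continuous_on UNIV f"
| "C_k (Suc k) f \<longleftrightarrow> (\<forall>x. f differentiable (at x)) \<and>
     (\<forall>v. C_k k (\<lambda>x. frechet_derivative f (at x) v))"

definition smooth :: "('a::euclidean_space \<Rightarrow> real) \<Rightarrow> bool" where
  "smooth f \<longleftrightarrow> (\<forall>k. C_k k f)"

definition gradient :: "(real ^ 'n \<Rightarrow> real) \<Rightarrow> real ^ 'n \<Rightarrow> real ^ 'n" where
  "gradient f x = (\<chi> j. frechet_derivative f (at x) (axis j 1))"

definition positive_definite :: "('a::zero \<Rightarrow> real) \<Rightarrow> bool" where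
  "positive_definite V \<longleftrightarrow> V 0 = 0 \<and> (\<forall>x. x \<noteq> 0 \<longrightarrow> 0 < V x)"

definition smooth_weak_lyapunov ::
    "('m::finite \<Rightarrow> real ^ 'n ^ 'n) \<Rightarrow> (real ^ 'n \<Rightarrow> real) \<Rightarrow> bool" where
  "smooth_weak_lyapunov A V \<longleftrightarrow> smooth V \<and> positive_definite V \<and>
     (\<forall>x. \<forall>w\<in>weights. gradient V x \<bullet> (weighted_matrix A w *v x) \<le> 0)"

text \<open>
  The classical \<open>\<epsilon>\<close>-\<open>\<delta>\<close> notion.  A finite family of non-overlapping compact intervals inside \<open>S\<close> is
  given as a division \<open>d\<close> of a set \<open>t \<subseteq> S\<close>; the interval $[a,b] \in d$ contributes
  $\|f(b) - f(a)\|$.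
\<close>

definition absolutely_continuous_on :: "real set \<Rightarrow> (real \<Rightarrow> 'a::real_normed_vector) \<Rightarrow> bool" where
  "absolutely_continuous_on S f \<longleftrightarrow>
     (\<forall>\<epsilon>>0. \<exists>\<delta>>0. \<forall>d t. d division_of t \<and> t \<subseteq> S \<and> (\<Sum>k\<in>d. Sup k - Inf k) < \<delta> \<longrightarrow>
        (\<Sum>k\<in>d. norm (f (Sup k) - f (Inf k))) < \<epsilon>)"

text \<open>
  Solutions in the sense of Caratheodory on $[0,\infty)$; the values of \<open>x\<close> and \<open>w\<close> at negative
  times are irrelevant.
\<close>

definition inclusion_solution ::
    "('m::finite \<Rightarrow> real ^ 'n ^ 'n) \<Rightarrow> (real \<Rightarrow> real ^ 'n) \<Rightarrow> bool" where
  "inclusion_solution A x \<longleftrightarrow>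
     (\<forall>T\<ge>0. absolutely_continuous_on {0..T} x) \<and>
     (\<exists>w. w \<in> borel_measurable (lebesgue_on {0..}) \<and> (\<forall>t\<ge>0. w t \<in> weights) \<and>
        (AE t in lebesgue_on {0..}.
           (x has_vector_derivative (weighted_matrix A (w t) *v x t)) (at t within {0..})))"

definition lyapunov_zero_set ::
    "('m::finite \<Rightarrow> real ^ 'n ^ 'n) \<Rightarrow> (real ^ 'n \<Rightarrow> real) \<Rightarrow> (real ^ 'n) set" where
  "lyapunov_zero_set A V = {x. (MIN i\<in>UNIV. - (gradient V x \<bullet> (A i *v x))) = 0}"

text \<open>
  The library sets \<open>infdist x {} = 0\<close>, so the notion below is meant for nonempty \<open>S\<close>; the set
  \<open>lyapunov_zero_set A V\<close> always contains the origin.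
\<close>

definition converges_to_set :: "(real \<Rightarrow> 'a::metric_space) \<Rightarrow> 'a set \<Rightarrow> bool" where
  "converges_to_set x S \<longleftrightarrow> ((\<lambda>t. infdist (x t) S) \<longlongrightarrow> 0) at_top"

lemma zero_in_lyapunov_zero_set: "0 \<in> lyapunov_zero_set A V"
  by (simp add: lyapunov_zero_set_def)

end

theory Submission
  imports Defs
begin

text \<open>
  The gradient inequality at the unit weight vectors says that every \<open>\<nabla>V(z) A\<^sub>i z\<close> is
  nonpositive, and \<open>\<nabla>V(z) A(w) z\<close> is a convex combination of these numbers.  Hence, away
  from the zero set, \<open>V\<close> decreases along solutions at a rate that is bounded below on every
  compact set, whatever \<open>w\<close> does (\<open>weak_lyapunov_uniform_decay\<close>).  The rest is an argument in
  the style of Barbalat: if a bounded, Lipschitz solution were at distance at least \<open>\<epsilon>\<close> from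
  the zero set at arbitrarily late times, it would stay at distance \<open>\<epsilon>/2\<close> for a fixed duration
  after each of them, and \<open>V\<close>, which never increases, would each time lose a fixed positive
  amount; but \<open>V\<close> is bounded below by \<open>0\<close>.

  Two points need care.

  \<^item> \<open>V\<close> need not be radially unbounded, so its sublevel sets may be unbounded.  Boundedness of
    solutions comes from linearity instead: near the origin positive definiteness traps
    solutions in the unit ball, and every solution becomes a small one after scaling
    (\<open>weak_lyapunov_solution_bounded\<close>).

  \<^item> Solutions satisfy the differential equation only almost everywhere, so the passage from the
    sign of the derivative to the growth of \<open>V(x(t))\<close> rests on absolute continuity.  This is
    the mean value inequality \<open>absolutely_continuous_increment_le\<close>.  Applied to linear functions
    in place of \<open>V\<close>, the same inequality shows that bounded solutions are Lipschitz.
\<close>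

section \<open>Absolutely continuous functions\<close>

lemma sum_length_division_le_measure:
  fixes d :: "real set set"
  assumes d: "d division_of t" and "t \<subseteq> U" and U: "U \<in> lmeasurable"
  shows "(\<Sum>k\<in>d. Sup k - Inf k) \<le> measure lebesgue U"
proof -
  have fin: "finite d" using d by blast
  have lm: "k \<in> lmeasurable" if "k \<in> d" for k
    using division_ofD(4)[OF d that] by auto
  have "(\<Sum>k\<in>d. Sup k - Inf k) = (\<Sum>k\<in>d. measure lebesgue k)"
  proof (rule sum.cong[OF refl])
    fix k assume "k \<in> d"
    then obtain u v where "k = cbox u v" "k \<noteq> {}"
      using division_ofD(3,4)[OF d] by metis
    then show "Sup k - Inf k = measure lebesgue k" by auto
  qed
  also have "\<dots> = measure lebesgue (\<Union>d)"
  proof (rule measure_negligible_finite_Union[symmetric, OF fin lm])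
    show "pairwise (\<lambda>S T. negligible (S \<inter> T)) d"
    proof (clarsimp simp: pairwise_def)
      fix S T assume ST: "S \<in> d" "T \<in> d" "S \<noteq> T"
      then have "convex (S \<inter> T)" 
        using division_ofD(4)[OF d] by (metis convex_Int convex_box(1))
      moreover have "interior (S \<inter> T) = {}"
        using division_ofD(5)[OF d ST] by (simp add: interior_Int)
      ultimately show "negligible (S \<inter> T)"
        by (simp add: negligible_convex_interior)
    qed
  qed
  also have "\<dots> \<le> measure lebesgue U"
  proof (rule measure_mono_fmeasurable[OF _ _ U])
    show "\<Union>d \<subseteq> U" using division_ofD(6)[OF d] assms by simp
    show "\<Union>d \<in> sets lebesgue" using fin lm by (auto intro!: sets.finite_Union)
  qed
  finally show ?thesis .
qed

text \<open>
  The intervals of a tagged division that is fine for a suitable gauge fall into two classes.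
  Those tagged outside \<open>N\<close> lie so close to their tag that the derivative there controls the
  increment; those tagged in \<open>N\<close> lie in an open set of small measure around \<open>N\<close>, so their
  increments are small in total by absolute continuity.  The increments add up to
  \<open>f b - f a\<close>.
\<close>

lemma absolutely_continuous_increment_le:
  fixes f :: "real \<Rightarrow> real"
  assumes ac: "absolutely_continuous_on {a..b} f" and "a \<le> b" and N: "negligible N"
    and der: "\<And>t. t \<in> {a..b} - N \<Longrightarrow>
      \<exists>D\<le>c. (f has_vector_derivative D) (at t within {a..b})"
  shows "f b - f a \<le> c * (b - a)"
proof -
  have main: "f b - f a \<le> c * (b - a) + \<epsilon> * (b - a + 2)" if "\<epsilon> > 0" for \<epsilon> :: real
  proof -
    obtain \<delta> where "\<delta> > 0" and \<delta>: "\<And>d t. d division_of t \<Longrightarrow> t \<subseteq> {a..b} \<Longrightarrow>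
        (\<Sum>k\<in>d. Sup k - Inf k) < \<delta> \<Longrightarrow> (\<Sum>k\<in>d. norm (f (Sup k) - f (Inf k))) < \<epsilon>"
      using ac \<open>\<epsilon> > 0\<close> unfolding absolutely_continuous_on_def by meson
    \<comment> \<open>The second bound on the measure serves the lengths: \<open>c\<close> may be negative, and discarding
      the intervals tagged in \<open>N\<close> then costs \<open>\<bar>c\<bar>\<close> times their total length.\<close>
    define m where "m = min \<delta> (\<epsilon> / (\<bar>c\<bar> + 1))"
    have "m > 0" unfolding m_def using \<open>\<delta> > 0\<close> \<open>\<epsilon> > 0\<close> by simp
    have N0: "N \<in> null_sets lebesgue" using N by (simp add: negligible_iff_null_sets)
    obtain T where T: "open T" "N \<subseteq> T" "(T - N) \<in> lmeasurable"
      "emeasure lebesgue (T - N) < ennreal m"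
      using sets_lebesgue_outer_open[OF _ \<open>m > 0\<close>] N0 by blast
    have "T \<in> lmeasurable" using T N
      by (metis Diff_partition fmeasurable.Un negligible_imp_measurable)
    have "emeasure lebesgue T = emeasure lebesgue (T - N)"
      using T(3) N0 by (metis T(1) emeasure_Diff_null_set fmeasurableD \<open>T \<in> lmeasurable\<close>)
    then have mT: "measure lebesgue T < m"
      using T(4) \<open>T \<in> lmeasurable\<close> \<open>m > 0\<close>
      by (metis emeasure_eq_measure2 ennreal_less_iff measure_nonneg)
    \<comment> \<open>The straddle estimate: the interval must contain the tag \<open>t\<close>, so that the errors on both
      sides of \<open>t\<close> are measured against \<open>v - u\<close>.\<close>
    have "\<exists>r>0. \<forall>u v. u \<in> {a..b} \<longrightarrow> v \<in> {a..b} \<longrightarrow> u \<le> t \<longrightarrow> t \<le> v \<longrightarrow>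
        u \<in> ball t r \<longrightarrow> v \<in> ball t r \<longrightarrow> f v - f u \<le> (c + \<epsilon>) * (v - u)"
      if t: "t \<in> {a..b} - N" for t
    proof -
      obtain D where "D \<le> c" and D: "(f has_vector_derivative D) (at t within {a..b})"
        using der[OF t] by blast
      obtain r where "r > 0" and r: "\<And>y. y \<in> {a..b} \<Longrightarrow> norm (y - t) < r \<Longrightarrow>
          norm (f y - f t - (y - t) *\<^sub>R D) \<le> \<epsilon> * norm (y - t)"
        using D \<open>\<epsilon> > 0\<close> unfolding has_vector_derivative_def has_derivative_within_alt by blast
      have "f v - f u \<le> (c + \<epsilon>) * (v - u)"
        if uv: "u \<in> {a..b}" "v \<in> {a..b}" "u \<le> t" "t \<le> v" "u \<in> ball t r" "v \<in> ball t r" for u v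
      proof -
        have "f v - f t \<le> (v - t) * D + \<epsilon> * (v - t)" 
          using r[of v] uv by (auto simp: dist_real_def)
        moreover have "f t - f u \<le> (t - u) * D + \<epsilon> * (t - u)" 
          using r[of u] uv by (auto simp: dist_real_def algebra_simps)
        ultimately have "f v - f u \<le> (v - u) * D + \<epsilon> * (v - u)" by (simp add: algebra_simps)
        also have "\<dots> \<le> (v - u) * c + \<epsilon> * (v - u)" 
          using \<open>D \<le> c\<close> uv by (intro add_right_mono mult_left_mono) auto
        finally show ?thesis by (simp add: algebra_simps)
      qed
      then show ?thesis using \<open>r > 0\<close> by blast
    qed
    then obtain r where r: "\<And>t. t \<in> {a..b} - N \<Longrightarrow> r t > 0" 
      "\<And>t u v. t \<in> {a..b} - N \<Longrightarrow> u \<in> {a..b} \<Longrightarrow> v \<in> {a..b} \<Longrightarrow> u \<le> t \<Longrightarrow> t \<le> v \<Longrightarrow>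
        u \<in> ball t (r t) \<Longrightarrow> v \<in> ball t (r t) \<Longrightarrow> f v - f u \<le> (c + \<epsilon>) * (v - u)"
      by metis
    define \<gamma> where "\<gamma> t = (if t \<in> N then T else if t \<in> {a..b} then ball t (r t) else UNIV)" for t
    have "gauge \<gamma>" 
      unfolding gauge_def \<gamma>_def using T r(1) by auto
    then obtain p where p: "p tagged_division_of {a..b}" and fine: "\<gamma> fine p"
      using fine_division_exists_real by blast
    note pD = tagged_division_ofD[OF p]
    have tag: "\<exists>u v. k = {u..v} \<and> u \<le> t \<and> t \<le> v \<and> a \<le> u \<and> v \<le> b \<and> Sup k = v \<and> Inf k = u" 
      if "(t, k) \<in> p" for t k
    proof -
      obtain u v where "k = cbox u v" using pD(4)[OF \<open>(t,k) \<in> p\<close>] by blast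
      moreover have "t \<in> k" "k \<subseteq> {a..b}" using pD(2,3)[OF \<open>(t,k) \<in> p\<close>] by auto
      ultimately show ?thesis by force
    qed
    define q where "q = {z \<in> p. fst z \<in> N}"
    have "q \<subseteq> p" by (auto simp: q_def)
    have fin: "finite p" "finite q" using pD(1) \<open>q \<subseteq> p\<close> by (auto intro: finite_subset)
    have q: "q tagged_division_of \<Union>(snd ` q)"
      using p \<open>q \<subseteq> p\<close> 
      by (meson tagged_division_of_def tagged_partial_division_of_Union_self tagged_partial_division_subset)
    have qd: "(snd ` q) division_of \<Union>(snd ` q)" by (rule division_of_tagged_division[OF q])
    have sub: "\<Union>(snd ` q) \<subseteq> {a..b} \<inter> T"
    proof -
      have "k \<subseteq> {a..b} \<inter> T" if "(t,k) \<in> q" for t k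
        using that fine pD(3) unfolding q_def fine_def \<gamma>_def by fastforce
      then show ?thesis by fastforce
    qed
    have len: "(\<Sum>k\<in>snd ` q. Sup k - Inf k) < m"
      using sum_length_division_le_measure[OF qd _ \<open>T \<in> lmeasurable\<close>] sub mT by force
    have deg: "g (Sup k) (Inf k) = 0" 
      if "\<And>y. g y y = 0" "box u v = {}" "k = cbox u v" "k \<noteq> {}" for g :: "real \<Rightarrow> real \<Rightarrow> real" and k u v
    proof -
      have "u = v" using that by auto
      then show ?thesis using that by simp
    qed
    \<comment> \<open>Absolute continuity speaks of divisions, where an interval counts once; in \<open>q\<close> it may
      carry several tags, but only if it is degenerate and contributes nothing.\<close>
    have img: "(\<Sum>(t,k)\<in>q. g (Sup k) (Inf k)) = (\<Sum>k\<in>snd ` q. g (Sup k) (Inf k))" 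
      if "\<And>y. g y y = 0" for g :: "real \<Rightarrow> real \<Rightarrow> real"
    proof -
      \<comment> \<open>The empty set is singled out because \<open>Sup {}\<close> and \<open>Inf {}\<close> are unspecified reals.\<close>
      have "(\<Sum>(t,k)\<in>q. if k = {} then 0 else g (Sup k) (Inf k)) 
          = (\<Sum>k\<in>snd ` q. if k = {} then 0 else g (Sup k) (Inf k))"
        by (rule sum.over_tagged_division_lemma[OF q]) (use that deg in auto)
      moreover have "k \<noteq> {}" if "(t,k) \<in> q" for t k
        using pD(2) that unfolding q_def by auto
      ultimately show ?thesis 
        by (smt (verit, ccfv_SIG) case_prod_conv imageE prod.collapse sum.cong)
    qed
    have bad: "(\<Sum>(t,k)\<in>q. f (Sup k) - f (Inf k)) \<le> \<epsilon>"
    proof -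
      have "(\<Sum>(t,k)\<in>q. f (Sup k) - f (Inf k)) = (\<Sum>k\<in>snd ` q. f (Sup k) - f (Inf k))"
        by (rule img[where g = "\<lambda>u v. f u - f v"]) simp
      also have "\<dots> \<le> (\<Sum>k\<in>snd ` q. norm (f (Sup k) - f (Inf k)))"
        by (rule sum_mono) simp
      also have "\<dots> < \<epsilon>"
        using \<delta>[OF qd] sub len unfolding m_def by auto
      finally show ?thesis by simp
    qed
    have lenq: "(\<Sum>(t,k)\<in>q. Sup k - Inf k) < m" 
      using img[where g = "\<lambda>u v. u - v"] len by simp
    have lenq0: "(\<Sum>(t,k)\<in>q. Sup k - Inf k) \<ge> 0" 
      using tag \<open>q \<subseteq> p\<close> by (fastforce intro!: sum_nonneg)
    have split: "(\<Sum>z\<in>p. h z) = (\<Sum>z\<in>p - q. h z) + (\<Sum>z\<in>q. h z)" for h :: "real \<times> real set \<Rightarrow> real"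
      by (rule sum.subset_diff[OF \<open>q \<subseteq> p\<close> fin(1)])
    have good: "(\<Sum>(t,k)\<in>p - q. f (Sup k) - f (Inf k)) \<le> (c + \<epsilon>) * (\<Sum>(t,k)\<in>p - q. Sup k - Inf k)"
      unfolding sum_distrib_left
    proof (rule sum_mono, clarify)
      fix t k assume tk: "(t,k) \<in> p" "(t,k) \<notin> q"
      obtain u v where uv: "k = {u..v}" "u \<le> t" "t \<le> v" "a \<le> u" "v \<le> b" "Sup k = v" "Inf k = u"
        using tag[OF tk(1)] by blast
      have "t \<notin> N" using tk by (auto simp: q_def)
      have "k \<subseteq> ball t (r t)" using fine tk(1) \<open>t \<notin> N\<close> uv unfolding fine_def \<gamma>_def by force
      then have "u \<in> ball t (r t)" "v \<in> ball t (r t)" using uv by (metis atLeastAtMost_iff order.refl order.trans subsetD)+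
      then show "f (Sup k) - f (Inf k) \<le> (c + \<epsilon>) * (Sup k - Inf k)"
        using r(2)[of t u v] uv \<open>t \<notin> N\<close> by auto
    qed
    have tot: "(\<Sum>(t,k)\<in>p. f (Sup k) - f (Inf k)) = f b - f a"
      by (rule additive_tagged_division_1[OF \<open>a \<le> b\<close> p])
    have totl: "(\<Sum>(t,k)\<in>p. Sup k - Inf k) = b - a"
      using additive_tagged_division_1[OF \<open>a \<le> b\<close> p, of id] by simp
    define l where "l = (\<Sum>(t,k)\<in>q. Sup k - Inf k)"
    have "f b - f a \<le> (c + \<epsilon>) * (b - a - l) + \<epsilon>"
      using good bad tot totl split[of "\<lambda>(t,k). f (Sup k) - f (Inf k)"] 
        split[of "\<lambda>(t,k). Sup k - Inf k"] unfolding l_def by (smt (verit))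
    moreover have "- c * l \<le> \<epsilon>"
    proof -
      have "- c * l \<le> (\<bar>c\<bar> + 1) * (\<epsilon> / (\<bar>c\<bar> + 1))" 
        using lenq lenq0 unfolding l_def[symmetric] m_def by (intro mult_mono) auto
      then show ?thesis by simp
    qed
    moreover have "\<epsilon> * l \<ge> 0" using \<open>\<epsilon> > 0\<close> lenq0 l_def by simp
    ultimately show ?thesis by (simp add: algebra_simps)
  qed
  show ?thesis
  proof (rule field_le_epsilon)
    fix e :: real assume "e > 0"
    have "b - a + 2 > 0" using \<open>a \<le> b\<close> by simp
    then show "f b - f a \<le> c * (b - a) + e" 
      using main[of "e / (b - a + 2)"] \<open>e > 0\<close> by simp
  qed
qed

lemma absolutely_continuous_on_subset:
  assumes "absolutely_continuous_on S f" and "T \<subseteq> S"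
  shows "absolutely_continuous_on T f"
  unfolding absolutely_continuous_on_def
proof (intro allI impI)
  fix \<epsilon> :: real assume "\<epsilon> > 0"
  then obtain \<delta> where "\<delta> > 0" and \<delta>: "\<And>d t. d division_of t \<Longrightarrow> t \<subseteq> S \<Longrightarrow>
      (\<Sum>k\<in>d. Sup k - Inf k) < \<delta> \<Longrightarrow> (\<Sum>k\<in>d. norm (f (Sup k) - f (Inf k))) < \<epsilon>"
    using assms(1) unfolding absolutely_continuous_on_def by meson
  show "\<exists>\<delta>>0. \<forall>d t. d division_of t \<and> t \<subseteq> T \<and> (\<Sum>k\<in>d. Sup k - Inf k) < \<delta> \<longrightarrow>
      (\<Sum>k\<in>d. norm (f (Sup k) - f (Inf k))) < \<epsilon>"
    using \<open>\<delta> > 0\<close> \<delta> assms(2) by (intro exI[of _ \<delta>]) auto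
qed

lemma absolutely_continuous_on_lipschitz_comp:
  fixes f :: "real \<Rightarrow> 'a::real_normed_vector" and g :: "'a \<Rightarrow> 'b::real_normed_vector"
  assumes ac: "absolutely_continuous_on S f" and L: "L-lipschitz_on X g" and X: "f ` S \<subseteq> X"
  shows "absolutely_continuous_on S (\<lambda>t. g (f t))"
  unfolding absolutely_continuous_on_def
proof (intro allI impI)
  fix \<epsilon> :: real assume "\<epsilon> > 0"
  have "L \<ge> 0" using L by (rule lipschitz_on_nonneg)
  then have "\<epsilon> / (L + 1) > 0" using \<open>\<epsilon> > 0\<close> by simp
  then obtain \<delta> where "\<delta> > 0" and \<delta>: "\<And>d t. d division_of t \<Longrightarrow> t \<subseteq> S \<Longrightarrow>
      (\<Sum>k\<in>d. Sup k - Inf k) < \<delta> \<Longrightarrow> (\<Sum>k\<in>d. norm (f (Sup k) - f (Inf k))) < \<epsilon> / (L + 1)"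
    using ac unfolding absolutely_continuous_on_def by meson
  have "(\<Sum>k\<in>d. norm (g (f (Sup k)) - g (f (Inf k)))) < \<epsilon>"
    if d: "d division_of t" "t \<subseteq> S" "(\<Sum>k\<in>d. Sup k - Inf k) < \<delta>" for d t
  proof -
    have "norm (g (f (Sup k)) - g (f (Inf k))) \<le> (L + 1) * norm (f (Sup k) - f (Inf k))" 
      if k: "k \<in> d" for k
    proof -
      obtain u v where "k = cbox u v" "k \<noteq> {}" "k \<subseteq> S"
        using division_ofD(2,3,4)[OF d(1) k] d(2) by blast
      then have "Sup k \<in> S" "Inf k \<in> S" by auto
      then have "norm (g (f (Sup k)) - g (f (Inf k))) \<le> L * norm (f (Sup k) - f (Inf k))"
        using L X by (metis dist_norm image_subset_iff lipschitz_onD)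
      then show ?thesis by (simp add: distrib_right add_increasing2)
    qed
    then have "(\<Sum>k\<in>d. norm (g (f (Sup k)) - g (f (Inf k)))) 
        \<le> (L + 1) * (\<Sum>k\<in>d. norm (f (Sup k) - f (Inf k)))"
      unfolding sum_distrib_left by (rule sum_mono)
    also have "\<dots> < (L + 1) * (\<epsilon> / (L + 1))"
      using \<delta>[OF d] \<open>L \<ge> 0\<close> by (intro mult_strict_left_mono) auto
    finally show ?thesis using \<open>L \<ge> 0\<close> by simp
  qed
  then show "\<exists>\<delta>>0. \<forall>d t. d division_of t \<and> t \<subseteq> S \<and> (\<Sum>k\<in>d. Sup k - Inf k) < \<delta> \<longrightarrow>
      (\<Sum>k\<in>d. norm (g (f (Sup k)) - g (f (Inf k)))) < \<epsilon>"
    using \<open>\<delta> > 0\<close> by blast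
qed

lemma absolutely_continuous_imp_continuous_on:
  fixes f :: "real \<Rightarrow> 'a::real_normed_vector"
  assumes ac: "absolutely_continuous_on {a..b} f"
  shows "continuous_on {a..b} f"
  unfolding continuous_on_iff
proof (intro ballI allI impI)
  fix t \<epsilon> :: real assume t: "t \<in> {a..b}" and "\<epsilon> > 0"
  then obtain \<delta> where "\<delta> > 0" and \<delta>: "\<And>d t. d division_of t \<Longrightarrow> t \<subseteq> {a..b} \<Longrightarrow>
      (\<Sum>k\<in>d. Sup k - Inf k) < \<delta> \<Longrightarrow> (\<Sum>k\<in>d. norm (f (Sup k) - f (Inf k))) < \<epsilon>"
    using ac unfolding absolutely_continuous_on_def by meson
  have *: "norm (f v - f u) < \<epsilon>" if "a \<le> u" "u \<le> v" "v \<le> b" "v - u < \<delta>" for u v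
    using \<delta>[of "{{u..v}}" "{u..v}"] that division_of_self[of u v] by auto
  have "dist (f s) (f t) < \<epsilon>" if "s \<in> {a..b}" "dist s t < \<delta>" for s
    using *[of s t] *[of t s] t that
    by (cases "s \<le> t") (auto simp: dist_norm norm_minus_commute)
  then show "\<exists>\<delta>>0. \<forall>s\<in>{a..b}. dist s t < \<delta> \<longrightarrow> dist (f s) (f t) < \<epsilon>"
    using \<open>\<delta> > 0\<close> by blast
qed

section \<open>Continuously differentiable functions along solutions\<close>

lemma C1_has_derivative_gradient:
  fixes V :: "real ^ 'n \<Rightarrow> real"
  assumes "C_k 1 V"
  shows "(V has_derivative (\<lambda>v. gradient V z \<bullet> v)) (at z)"
proof -
  have d: "(V has_derivative frechet_derivative V (at z)) (at z)"
    using assms by (simp add: frechet_derivative_works[symmetric])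
  have lin: "linear (frechet_derivative V (at z))"
    using d by (simp add: has_derivative_bounded_linear bounded_linear.linear)
  have "frechet_derivative V (at z) v = gradient V z \<bullet> v" for v
  proof -
    have "frechet_derivative V (at z) v = frechet_derivative V (at z) (\<Sum>j\<in>UNIV. (v $ j) *\<^sub>R axis j 1)"
      by (simp only: basis_expansion[of v, unfolded scalar_mult_eq_scaleR])
    also have "\<dots> = (\<Sum>j\<in>UNIV. v $ j * frechet_derivative V (at z) (axis j 1))"
      by (simp add: linear_sum[OF lin] linear_cmul[OF lin])
    finally show ?thesis by (simp add: gradient_def inner_vec_def mult.commute)
  qed
  then have "frechet_derivative V (at z) = (\<lambda>v. gradient V z \<bullet> v)" by blast
  then show ?thesis using d by simp
qed

lemma C1_continuous_gradient:
  fixes V :: "real ^ 'n \<Rightarrow> real"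
  assumes "C_k 1 V"
  shows "continuous_on S (gradient V)"
  unfolding gradient_def
proof (rule continuous_on_vec_lambda)
  fix j :: 'n
  have "continuous_on UNIV (\<lambda>z. frechet_derivative V (at z) (axis j 1))"
    using assms by simp
  then show "continuous_on S (\<lambda>z. frechet_derivative V (at z) (axis j 1))"
    by (rule continuous_on_subset) simp
qed

lemma C1_lipschitz_on_cball:
  fixes V :: "real ^ 'n \<Rightarrow> real"
  assumes "C_k 1 V"
  obtains L where "L-lipschitz_on (cball 0 R) V"
proof -
  have "compact (gradient V ` cball 0 R)"
    by (intro compact_continuous_image C1_continuous_gradient assms compact_cball)
  then obtain L where L: "L > 0" "\<And>z. z \<in> cball 0 R \<Longrightarrow> norm (gradient V z) \<le> L"
    by (metis bounded_pos compact_imp_bounded imageI)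
  have "L-lipschitz_on (cball 0 R) V"
  proof (rule lipschitz_onI)
    fix y z :: "real ^ 'n" assume yz: "y \<in> cball 0 R" "z \<in> cball 0 R"
    have "norm (V y - V z) \<le> L * norm (y - z)"
    proof (rule differentiable_bound[OF convex_cball _ _ yz])
      fix u :: "real ^ 'n" assume u: "u \<in> cball 0 R"
      show "(V has_derivative (\<lambda>v. gradient V u \<bullet> v)) (at u within cball 0 R)"
        by (rule has_derivative_at_withinI[OF C1_has_derivative_gradient[OF assms]])
      have "onorm (\<lambda>v. gradient V u \<bullet> v) \<le> norm (gradient V u)"
        by (rule onorm_le) (simp add: Cauchy_Schwarz_ineq2)
      then show "onorm (\<lambda>v. gradient V u \<bullet> v) \<le> L" using L(2)[OF u] by linarith
    qed
    then show "dist (V y) (V z) \<le> L * dist y z" by (simp add: dist_norm)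
  qed (use L in simp)
  then show thesis by (rule that)
qed

lemma inclusion_solution_continuous_on:
  assumes "inclusion_solution A x"
  shows "continuous_on {0..T} x"
proof (cases "T \<ge> 0")
  case True
  then have "absolutely_continuous_on {0..T} x"
    using assms unfolding inclusion_solution_def by blast
  then show ?thesis by (rule absolutely_continuous_imp_continuous_on)
qed simp

text \<open>
  The bound is uniform over all weights because the weight function that drives \<open>x\<close> is
  arbitrary.  On the compact range of \<open>x\<close> the function \<open>V\<close> is Lipschitz, so \<open>V(x(t))\<close> is absolutely continuous and the
  chain rule gives its derivative almost everywhere.
\<close>

lemma inclusion_solution_increment_le:
  fixes A :: "'m::finite \<Rightarrow> real ^ 'n ^ 'n"
  assumes sol: "inclusion_solution A x" and C1: "C_k 1 V" and "0 \<le> a" "a \<le> b"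
    and bound: "\<And>t w. t \<in> {a..b} \<Longrightarrow> w \<in> weights \<Longrightarrow>
      gradient V (x t) \<bullet> (weighted_matrix A w *v x t) \<le> c"
  shows "V (x b) - V (x a) \<le> c * (b - a)"
proof -
  obtain w where w: "\<And>t. t \<ge> 0 \<Longrightarrow> w t \<in> weights" 
    and ae: "AE t in lebesgue_on {0..}. 
      (x has_vector_derivative (weighted_matrix A (w t) *v x t)) (at t within {0..})"
    using sol unfolding inclusion_solution_def by blast
  obtain N where N: "N \<in> null_sets (lebesgue_on {0..})"
    and N2: "\<And>t. t \<ge> 0 \<Longrightarrow> t \<notin> N \<Longrightarrow>
      (x has_vector_derivative (weighted_matrix A (w t) *v x t)) (at t within {0..})"
    using ae unfolding eventually_ae_filter by (auto simp: space_restrict_space)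
  have "negligible N"
    using N by (simp add: negligible_iff_null_sets null_sets_restrict_space)
  have ac: "absolutely_continuous_on {a..b} x"
    using sol \<open>0 \<le> a\<close> \<open>a \<le> b\<close> unfolding inclusion_solution_def
    by (meson absolutely_continuous_on_subset atLeastatMost_subset_iff order_refl order_trans)
  obtain R where R: "x ` {a..b} \<subseteq> cball 0 R"
    using compact_continuous_image[OF absolutely_continuous_imp_continuous_on[OF ac] compact_Icc]
    by (meson bounded_subset_ballD compact_imp_bounded ball_subset_cball order_trans)
  obtain L where L: "L-lipschitz_on (cball 0 R) V" using C1_lipschitz_on_cball[OF C1] by blast
  show ?thesis
  proof (rule absolutely_continuous_increment_le[OF _ \<open>a \<le> b\<close> \<open>negligible N\<close>, where f = "\<lambda>t. V (x t)"])
    show "absolutely_continuous_on {a..b} (\<lambda>t. V (x t))"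
      by (rule absolutely_continuous_on_lipschitz_comp[OF ac L R])
    fix t assume t: "t \<in> {a..b} - N"
    have "(x has_vector_derivative (weighted_matrix A (w t) *v x t)) (at t within {a..b})"
      by (rule has_vector_derivative_within_subset[OF N2]) (use t \<open>0 \<le> a\<close> in auto)
    then have "((\<lambda>s. V (x s)) has_derivative 
        (\<lambda>h. gradient V (x t) \<bullet> (h *\<^sub>R (weighted_matrix A (w t) *v x t)))) (at t within {a..b})"
      unfolding has_vector_derivative_def
      by (rule has_derivative_compose[OF _ C1_has_derivative_gradient[OF C1]])
    then have "((\<lambda>s. V (x s)) has_vector_derivative 
        (gradient V (x t) \<bullet> (weighted_matrix A (w t) *v x t))) (at t within {a..b})"
      unfolding has_vector_derivative_def by simp
    moreover have "gradient V (x t) \<bullet> (weighted_matrix A (w t) *v x t) \<le> c"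
      using bound w t \<open>0 \<le> a\<close> by simp
    ultimately show "\<exists>D\<le>c. ((\<lambda>s. V (x s)) has_vector_derivative D) (at t within {a..b})"
      by blast
  qed
qed

text \<open>
  Linear functions are test functions for the growth bound above: they turn a bound on the
  velocity into a bound on the displacement.
\<close>

lemma C1_inner_left: "C_k 1 (\<lambda>z::real ^ 'n. y \<bullet> z)"
  and gradient_inner_left: "gradient (\<lambda>z::real ^ 'n. y \<bullet> z) u = y"
proof -
  have d: "((\<lambda>z::real ^ 'n. y \<bullet> z) has_derivative (\<lambda>v. y \<bullet> v)) (at u)" for u
    by (auto intro!: derivative_eq_intros)
  have fd: "frechet_derivative (\<lambda>z::real ^ 'n. y \<bullet> z) (at u) = (\<lambda>v. y \<bullet> v)" for u
    using frechet_derivative_at[OF d] by simp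
  show "C_k 1 (\<lambda>z::real ^ 'n. y \<bullet> z)"
    using d by (auto simp: fd differentiable_def)
  show "gradient (\<lambda>z::real ^ 'n. y \<bullet> z) u = y"
    by (simp add: gradient_def fd inner_axis vec_eq_iff)
qed

section \<open>Boundedness and Lipschitz continuity of solutions\<close>

lemma weighted_matrix_mult_vec:
  "weighted_matrix A w *v z = (\<Sum>i\<in>UNIV. w $ i *\<^sub>R (A i *v z))"
proof -
  have lin: "linear (\<lambda>B. B *v z)"
    by (rule linearI) (simp_all add: matrix_vector_mult_add_rdistrib scaleR_matrix_vector_assoc)
  then show ?thesis
    unfolding weighted_matrix_def
    by (simp add: linear_sum[OF lin] scaleR_matrix_vector_assoc)
qed

lemma norm_weighted_matrix_le:
  fixes A :: "'m::finite \<Rightarrow> real ^ 'n ^ 'n"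
  assumes "w \<in> weights"
  shows "norm (weighted_matrix A w *v z) \<le> (\<Sum>i\<in>UNIV. onorm ((*v) (A i))) * norm z"
proof -
  have w: "0 \<le> w $ i" "w $ i \<le> 1" for i
    using assms member_le_sum[of i UNIV "($) w"] unfolding weights_def by auto
  have "norm (weighted_matrix A w *v z) \<le> (\<Sum>i\<in>UNIV. norm (w $ i *\<^sub>R (A i *v z)))"
    unfolding weighted_matrix_mult_vec by (rule norm_sum)
  also have "\<dots> \<le> (\<Sum>i\<in>UNIV. onorm ((*v) (A i)) * norm z)"
  proof (rule sum_mono)
    fix i
    have "norm (w $ i *\<^sub>R (A i *v z)) \<le> norm (A i *v z)"
      using w by (simp add: mult_left_le_one_le)
    also have "\<dots> \<le> onorm ((*v) (A i)) * norm z"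
      by (rule onorm[OF matrix_vector_mul_bounded_linear])
    finally show "norm (w $ i *\<^sub>R (A i *v z)) \<le> onorm ((*v) (A i)) * norm z" .
  qed
  finally show ?thesis by (simp add: sum_distrib_right)
qed

lemma inclusion_solution_scaleR:
  fixes A :: "'m::finite \<Rightarrow> real ^ 'n ^ 'n"
  assumes "inclusion_solution A x"
  shows "inclusion_solution A (\<lambda>t. s *\<^sub>R x t)"
proof -
  have lip: "\<bar>s\<bar>-lipschitz_on UNIV (\<lambda>z::real ^ 'n. s *\<^sub>R z)"
    by (rule lipschitz_onI) (auto simp: dist_norm scaleR_diff_right[symmetric])
  have ac: "absolutely_continuous_on {0..T} (\<lambda>t. s *\<^sub>R x t)" if "T \<ge> 0" for T
  proof (rule absolutely_continuous_on_lipschitz_comp[OF _ lip subset_UNIV])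
    show "absolutely_continuous_on {0..T} x"
      using assms that unfolding inclusion_solution_def by blast
  qed
  moreover have "((\<lambda>t. s *\<^sub>R x t) has_vector_derivative B *v (s *\<^sub>R x t)) (at t within S)"
    if "(x has_vector_derivative B *v x t) (at t within S)" for B S t
    using bounded_linear.has_vector_derivative[OF bounded_linear_scaleR_right that, of s]
    by (simp add: matrix_vector_mult_scaleR)
  moreover obtain w where w: "w \<in> borel_measurable (lebesgue_on {0..})" "\<forall>t\<ge>0. w t \<in> weights"
    and "AE t in lebesgue_on {0..}.
      (x has_vector_derivative (weighted_matrix A (w t) *v x t)) (at t within {0..})"
    using assms unfolding inclusion_solution_def by blast
  ultimately have "AE t in lebesgue_on {0..}.
      ((\<lambda>t. s *\<^sub>R x t) has_vector_derivative (weighted_matrix A (w t) *v (s *\<^sub>R x t))) (at t within {0..})"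
    by (auto elim!: eventually_mono)
  with w ac show ?thesis unfolding inclusion_solution_def by blast
qed

lemma weak_lyapunov_nonincreasing:
  assumes V: "smooth_weak_lyapunov A V" and sol: "inclusion_solution A x" and "0 \<le> a" "a \<le> b"
  shows "V (x b) \<le> V (x a)"
proof -
  have "C_k 1 V" using V unfolding smooth_weak_lyapunov_def smooth_def by blast
  moreover have "gradient V (x t) \<bullet> (weighted_matrix A w *v x t) \<le> 0" if "w \<in> weights" for t w
    using V that unfolding smooth_weak_lyapunov_def by blast
  ultimately show ?thesis 
    using inclusion_solution_increment_le[OF sol _ \<open>0 \<le> a\<close> \<open>a \<le> b\<close>, of V 0] by simp
qed

text \<open>
  Let \<open>m\<close> be the minimum of \<open>V\<close> on the unit sphere.  A solution that starts inside the unit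
  ball with \<open>V < m\<close> cannot cross the sphere, since \<open>V\<close> does not increase along it.  By
  continuity at \<open>0\<close> this applies to all solutions with small initial value, and multiplying
  by a small constant makes any initial value small.
\<close>

lemma weak_lyapunov_solution_bounded:
  fixes A :: "'m::finite \<Rightarrow> real ^ 'n ^ 'n"
  assumes V: "smooth_weak_lyapunov A V" and sol: "inclusion_solution A x"
  obtains R where "R > 0" "\<And>t. t \<ge> 0 \<Longrightarrow> norm (x t) \<le> R"
proof -
  have "C_k 0 V" using V unfolding smooth_weak_lyapunov_def smooth_def by blast
  then have cont: "continuous_on UNIV V" by simp
  have pd: "V 0 = 0" "\<And>z. z \<noteq> 0 \<Longrightarrow> V z > 0"
    using V unfolding smooth_weak_lyapunov_def positive_definite_def by auto
  have "axis undefined 1 \<in> (sphere 0 1 :: (real ^ 'n) set)" by simp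
  then have "sphere 0 1 \<noteq> ({} :: (real ^ 'n) set)" by blast
  then obtain u :: "real ^ 'n" where u: "u \<in> sphere 0 1" "\<And>z. z \<in> sphere 0 1 \<Longrightarrow> V u \<le> V z"
    using continuous_attains_inf[OF compact_sphere _ continuous_on_subset[OF cont]] by blast
  have "V u > 0" using u(1) by (intro pd(2)) auto
  then obtain \<delta> where "\<delta> > 0" and \<delta>: "\<And>z. norm z < \<delta> \<Longrightarrow> V z < V u"
    using cont pd(1) unfolding continuous_on_iff
    by (metis UNIV_I abs_le_D1 abs_less_iff diff_zero dist_norm dist_real_def)
  \<comment> \<open>The summand \<open>1\<close> keeps the denominator positive when \<open>x 0 = 0\<close>.\<close>
  define s where "s = min 1 \<delta> / (2 * (norm (x 0) + 1))"
  have "s > 0" using \<open>\<delta> > 0\<close> by (simp add: s_def add_nonneg_pos)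
  define y where "y t = s *\<^sub>R x t" for t
  have sy: "inclusion_solution A y" 
    unfolding y_def using inclusion_solution_scaleR[OF sol] .
  have "norm (y 0) < min 1 \<delta>"
  proof -
    have "norm (y 0) = min 1 \<delta> * (norm (x 0) / (2 * (norm (x 0) + 1)))"
      using \<open>\<delta> > 0\<close> by (simp add: y_def s_def)
    also have "\<dots> < min 1 \<delta> * 1"
      using \<open>\<delta> > 0\<close> by (intro mult_strict_left_mono) (auto simp: divide_simps add_nonneg_pos)
    finally show ?thesis by simp
  qed
  then have y0: "norm (y 0) < 1" "V (y 0) < V u" using \<delta> by auto
  have "norm (y t) \<le> 1" if t0: "t \<ge> 0" for t
  proof (rule ccontr)
    assume "\<not> norm (y t) \<le> 1"
    moreover have "continuous_on {0..t} (\<lambda>t. norm (y t))"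
      by (intro continuous_on_norm inclusion_solution_continuous_on[OF sy])
    ultimately obtain r where "0 \<le> r" "norm (y r) = 1"
      using IVT'[of "\<lambda>t. norm (y t)" 0 1 t] y0 t0 by auto
    then show False
      using weak_lyapunov_nonincreasing[OF V sy _ \<open>0 \<le> r\<close>] u(2)[of "y r"] y0 by simp
  qed
  then have "norm (x t) \<le> 1 / s" if "t \<ge> 0" for t
    using that \<open>s > 0\<close> unfolding y_def by (simp add: field_simps)
  then show thesis using that[of "1 / s"] \<open>s > 0\<close> by simp
qed

text \<open>
  A bounded solution has bounded velocity.  The scalar growth bound is applied to the inner
  product with the displacement \<open>x b - x a\<close> itself, which gives the square of its norm.
\<close>

lemma bounded_inclusion_solution_lipschitz:
  fixes A :: "'m::finite \<Rightarrow> real ^ 'n ^ 'n"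
  assumes sol: "inclusion_solution A x" and R: "\<And>t. t \<ge> 0 \<Longrightarrow> norm (x t) \<le> R"
  obtains L where "L > 0" "\<And>a b. 0 \<le> a \<Longrightarrow> a \<le> b \<Longrightarrow> norm (x b - x a) \<le> L * (b - a)"
proof -
  define K where "K = (\<Sum>i\<in>UNIV. onorm ((*v) (A i)))"
  have "K \<ge> 0" unfolding K_def
    by (intro sum_nonneg onorm_pos_le matrix_vector_mul_bounded_linear)
  have "R \<ge> 0" using R[of 0] norm_ge_zero order_trans by blast
  have "norm (x b - x a) \<le> (K * R + 1) * (b - a)" if "0 \<le> a" "a \<le> b" for a b
  proof -
    define y where "y = x b - x a"
    have "y \<bullet> x b - y \<bullet> x a \<le> (norm y * (K * R)) * (b - a)"
    proof (rule inclusion_solution_increment_le[OF sol C1_inner_left that])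
      fix t w assume "t \<in> {a..b}" and w: "w \<in> (weights :: (real ^ 'm) set)"
      then have "norm (x t) \<le> R" using R that by simp
      then have "norm (weighted_matrix A w *v x t) \<le> K * R"
        using norm_weighted_matrix_le[OF w, of A "x t"] \<open>K \<ge> 0\<close> unfolding K_def[symmetric]
        by (meson mult_left_mono order_trans)
      then have "norm y * norm (weighted_matrix A w *v x t) \<le> norm y * (K * R)"
        by (simp add: mult_left_mono)
      then show "gradient ((\<bullet>) y) (x t) \<bullet> (weighted_matrix A w *v x t) \<le> norm y * (K * R)"
        unfolding gradient_inner_left using norm_cauchy_schwarz order_trans by blast
    qed
    then have "norm y * norm y \<le> norm y * (K * R * (b - a))"
      by (simp add: y_def inner_diff_right[symmetric] dot_square_norm power2_eq_square mult.assoc)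
    then have "norm y \<le> K * R * (b - a)"
      using \<open>K \<ge> 0\<close> \<open>R \<ge> 0\<close> that by (cases "y = 0") auto
    then show ?thesis using that by (simp add: y_def distrib_right)
  qed
  moreover have "K * R + 1 > 0" using \<open>K \<ge> 0\<close> \<open>R \<ge> 0\<close> by (simp add: add_nonneg_pos)
  ultimately show thesis using that by blast
qed

section \<open>Decay away from the zero set\<close>

lemma weak_lyapunov_vertex_nonpos:
  assumes "smooth_weak_lyapunov A V"
  shows "gradient V z \<bullet> (A i *v z) \<le> 0"
proof -
  have "axis i 1 \<in> weights" by (simp add: weights_def axis_def)
  then have "gradient V z \<bullet> (weighted_matrix A (axis i 1) *v z) \<le> 0"
    using assms unfolding smooth_weak_lyapunov_def by blast
  moreover have "weighted_matrix A (axis i 1) = A i"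
    unfolding weighted_matrix_def axis_def by (simp add: if_distrib[of "\<lambda>r. r *\<^sub>R _"] cong: if_cong)
  ultimately show ?thesis by simp
qed

lemma lyapunov_zero_setI:
  assumes "smooth_weak_lyapunov A V" and "gradient V z \<bullet> (A i *v z) = 0"
  shows "z \<in> lyapunov_zero_set A V"
  unfolding lyapunov_zero_set_def mem_Collect_eq
proof (rule Min_eqI)
  show "0 \<in> range (\<lambda>i. - (gradient V z \<bullet> (A i *v z)))"
    using assms(2) by (intro image_eqI[of _ _ i]) auto
qed (use weak_lyapunov_vertex_nonpos[OF assms(1)] in auto)

text \<open>
  For each vertex \<open>i\<close> the continuous function \<open>\<nabla>V(z) A\<^sub>i z\<close> is negative on \<open>K\<close> and attains its
  maximum there.  There are finitely many vertices, and convex combinations inherit the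
  worst of their rates.
\<close>

lemma weak_lyapunov_uniform_decay:
  fixes A :: "'m::finite \<Rightarrow> real ^ 'n ^ 'n"
  assumes V: "smooth_weak_lyapunov A V" and "compact K" and disj: "K \<inter> lyapunov_zero_set A V = {}"
  obtains \<eta> where "\<eta> > 0"
    "\<And>z w. z \<in> K \<Longrightarrow> w \<in> weights \<Longrightarrow> gradient V z \<bullet> (weighted_matrix A w *v z) \<le> - \<eta>"
proof -
  have C1: "C_k 1 V" using V unfolding smooth_weak_lyapunov_def smooth_def by blast
  have "\<exists>\<eta>>0. \<forall>z\<in>K. gradient V z \<bullet> (A i *v z) \<le> - \<eta>" for i
  proof (cases "K = {}")
    case False
    have "continuous_on K (\<lambda>z. gradient V z \<bullet> (A i *v z))"
      by (intro continuous_intros C1_continuous_gradient[OF C1] 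
            linear_continuous_on matrix_vector_mul_bounded_linear)
    then obtain u where u: "u \<in> K" "\<forall>z\<in>K. gradient V z \<bullet> (A i *v z) \<le> gradient V u \<bullet> (A i *v u)"
      using continuous_attains_sup[OF \<open>compact K\<close> False] by blast
    have "gradient V u \<bullet> (A i *v u) \<noteq> 0" using lyapunov_zero_setI[OF V] disj u(1) by blast
    then have "gradient V u \<bullet> (A i *v u) < 0" 
      using weak_lyapunov_vertex_nonpos[OF V, of u i] by linarith
    then show ?thesis using u(2) by (intro exI[of _ "- (gradient V u \<bullet> (A i *v u))"]) simp
  qed (auto intro: exI[of _ 1])
  then obtain \<eta> where \<eta>: "\<And>i. \<eta> i > 0" "\<And>i z. z \<in> K \<Longrightarrow> gradient V z \<bullet> (A i *v z) \<le> - \<eta> i"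
    by metis
  define h where "h = Min (range \<eta>)"
  have "h > 0" unfolding h_def using \<eta>(1) by simp
  moreover have "gradient V z \<bullet> (weighted_matrix A w *v z) \<le> - h" if z: "z \<in> K" and w: "w \<in> weights" for z w
  proof -
    have "gradient V z \<bullet> (weighted_matrix A w *v z) = (\<Sum>i\<in>UNIV. w $ i * (gradient V z \<bullet> (A i *v z)))"
      by (simp add: weighted_matrix_mult_vec inner_sum_right)
    also have "\<dots> \<le> (\<Sum>i\<in>UNIV. w $ i * (- h))"
    proof (intro sum_mono mult_left_mono)
      fix i
      have "h \<le> \<eta> i" unfolding h_def by simp
      then show "gradient V z \<bullet> (A i *v z) \<le> - h" using \<eta>(2)[OF z, of i] by linarith
      show "0 \<le> w $ i" using w by (simp add: weights_def)
    qed
    also have "\<dots> = - h" using w by (simp add: sum_distrib_right[symmetric] weights_def sum_negf)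
    finally show ?thesis .
  qed
  ultimately show thesis by (rule that)
qed

section \<open>Convergence to the zero set\<close>

theorem proposition6:
  fixes A :: "'m::finite \<Rightarrow> real ^ 'n ^ 'n"
    and V :: "real ^ 'n \<Rightarrow> real"
    and x :: "real \<Rightarrow> real ^ 'n"
  assumes "smooth_weak_lyapunov A V"
    and "inclusion_solution A x"
  shows "converges_to_set x (lyapunov_zero_set A V)"
proof -
  note V = assms(1) and sol = assms(2)
  let ?N = "lyapunov_zero_set A V"
  have C1: "C_k 1 V" using V unfolding smooth_weak_lyapunov_def smooth_def by blast
  have Vnn: "V z \<ge> 0" for z
    using V unfolding smooth_weak_lyapunov_def positive_definite_def by (metis less_eq_real_def)
  obtain R where R: "\<And>t. t \<ge> 0 \<Longrightarrow> norm (x t) \<le> R"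
    using weak_lyapunov_solution_bounded[OF V sol] by blast
  obtain L where "L > 0" and L: "\<And>a b. 0 \<le> a \<Longrightarrow> a \<le> b \<Longrightarrow> norm (x b - x a) \<le> L * (b - a)"
    using bounded_inclusion_solution_lipschitz[OF sol R] by blast
  define \<nu> where "\<nu> = (INF t\<in>{0..}. V (x t))"
  have bdd: "bdd_below ((\<lambda>t. V (x t)) ` {0..})" using Vnn by (intro bdd_belowI2[of _ 0])
  have "\<exists>T. \<forall>t\<ge>T. infdist (x t) ?N < \<epsilon>" if "\<epsilon> > 0" for \<epsilon>
  proof -
    define K where "K = cball 0 R \<inter> {z. \<epsilon> / 2 \<le> infdist z ?N}"
    have "closed {z. \<epsilon> / 2 \<le> infdist z ?N}"
      by (intro closed_Collect_le continuous_intros)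
    then have "compact K" unfolding K_def by (simp add: compact_Int_closed)
    moreover have "K \<inter> ?N = {}" using \<open>\<epsilon> > 0\<close> by (auto simp: K_def)
    ultimately obtain \<eta> where "\<eta> > 0" and \<eta>: "\<And>z w. z \<in> K \<Longrightarrow> w \<in> weights \<Longrightarrow> 
        gradient V z \<bullet> (weighted_matrix A w *v z) \<le> - \<eta>"
      using weak_lyapunov_uniform_decay[OF V] by metis
    \<comment> \<open>The time within which the solution moves by at most \<open>\<epsilon> / 2\<close>.\<close>
    define \<delta> where "\<delta> = \<epsilon> / (2 * L)"
    have "\<delta> > 0" using \<open>\<epsilon> > 0\<close> \<open>L > 0\<close> by (simp add: \<delta>_def)
    have "\<nu> < \<nu> + \<eta> * \<delta>" using \<open>\<eta> > 0\<close> \<open>\<delta> > 0\<close> by simp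
    \<comment> \<open>After \<open>T\<close> there is not enough of \<open>V\<close> left to lose \<open>\<eta> * \<delta>\<close>.\<close>
    then obtain T where "T \<ge> 0" and T: "V (x T) < \<nu> + \<eta> * \<delta>"
      unfolding \<nu>_def using cINF_less_iff[OF _ bdd] by (metis atLeast_iff empty_iff order_refl)
    have "infdist (x t) ?N < \<epsilon>" if "t \<ge> T" for t
    proof (rule ccontr)
      assume far: "\<not> infdist (x t) ?N < \<epsilon>"
      have "t \<ge> 0" using \<open>T \<ge> 0\<close> that by simp
      have inK: "x s \<in> K" if s: "s \<in> {t..t + \<delta>}" for s
      proof -
        have "dist (x t) (x s) \<le> L * (s - t)"
          using L[OF \<open>t \<ge> 0\<close>, of s] s by (simp add: dist_norm norm_minus_commute)
        also have "\<dots> \<le> L * \<delta>" using s \<open>L > 0\<close> by simp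
        also have "\<dots> = \<epsilon> / 2" using \<open>L > 0\<close> by (simp add: \<delta>_def)
        finally have "\<epsilon> / 2 \<le> infdist (x s) ?N"
          using infdist_triangle[of "x t" ?N "x s"] far by linarith
        then show ?thesis using R[of s] s \<open>t \<ge> 0\<close> by (simp add: K_def)
      qed
      have "V (x (t + \<delta>)) - V (x t) \<le> - \<eta> * (t + \<delta> - t)"
        by (rule inclusion_solution_increment_le[OF sol C1 \<open>t \<ge> 0\<close>]) 
           (use \<open>\<delta> > 0\<close> \<eta> inK in auto)
      moreover have "V (x t) \<le> V (x T)"
        by (rule weak_lyapunov_nonincreasing[OF V sol \<open>T \<ge> 0\<close> that])
      moreover have "\<nu> \<le> V (x (t + \<delta>))"
        unfolding \<nu>_def by (rule cINF_lower[OF bdd]) (use \<open>t \<ge> 0\<close> \<open>\<delta> > 0\<close> in auto)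
      ultimately show False using T by simp
    qed
    then show ?thesis by blast
  qed
  then show ?thesis
    unfolding converges_to_set_def tendsto_iff eventually_at_top_linorder
    by (simp add: infdist_nonneg)
qed

end
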